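(* Let $\mathcal{C}$ be a braided fusion category over $k$ with universal grading group $U(\mathcal{C})$. Suppose $\mathcal{C}$ is generated as a fusion category by simple objects $X_1, \dots, X_n$. Then the exponent of $U(\mathcal{C})$ divides the least common multiple of $\operatorname{ord}(X_1), \dots, \operatorname{ord}(X_n)$. In particular, if $\mathcal{C}$ is generated by self-dual simple objects, then $U(\mathcal{C})$ is an elementary abelian $2$-group.
   Context: $k$ is an algebraically closed field of characteristic zero. A fusion category over $k$ is a $k$-linear semisimple rigid tensor category with finitely many isomorphism classes of simple objects, finite-dimensional Hom spaces and simple unit object $\mathbf{1}$. A fusion subcategory is a full tensor subcategory stable under direct sums and subobjects. The adjoint subcategory $\mathcal{C}_{\mathrm{ad}}$ is the fusion subcategory generated by $X \otimes X^*$, $X$ running over the simple objects of $\mathcal{C}$. A grading of $\mathcal{C}$ by a group $G$ is a decomposition $\mathcal{C} = \oplus_{g\in G}\mathcal{C}_g$ into full abelian subcategories with $\mathcal{C}_g^* = \mathcal{C}_{g^{-1}}$ and $\otimes$ mapping $\mathcal{C}_g\times \mathcal{C}_h$ to $\mathcal{C}_{gh}$; it is faithful if all $\mathcal{C}_g \neq 0$. Every fusion category has a canonical faithful grading, the universal grading, by a group $U(\mathcal{C})$ (the universal grading group), with trivial component $\mathcal{C}_e = \mathcal{C}_{\mathrm{ad}}$; every grading of $\mathcal{C}$ by a group $G$ is obtained from it through a unique group homomorphism $U(\mathcal{C}) \to G$. The order $\operatorname{ord}(X)$ of a nonzero object $X$ is the smallest integer $n \geq 1$ such that $\mathbf{1}$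 occurs with positive multiplicity in $X^{\otimes n}$. A simple object $X$ is self-dual if $X\simeq X^*$. The trivial group counts as an elementary abelian $2$-group. *)

theory Defs
  imports "HOL-Computational_Algebra.Polynomial" "HOL-Algebra.Group"
begin

section \<open>Linear and abelian categories\<close>

text \<open>
  The Hom spaces of a \<open>k\<close>-linear category are given as subspaces of one ambient vector space
  \<open>'m\<close>, and composition is a total operation on \<open>'m\<close> that is only constrained on composable
  pairs. This is no restriction: any small \<open>k\<close>-linear category is of this form, with \<open>'m\<close> the
  direct sum of all its Hom spaces and products of non-composable morphisms set to zero. The
  sets \<open>Mor A B\<close> may overlap (they all contain \<open>0\<close>), so notions such as monomorphism take
  source and target as explicit arguments.

  Full subcategories are represented by their sets of objects.
\<close>

record ('k, 'o, 'm) linear_cat =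
  Ob :: "'o set"
  Mor :: "'o \<Rightarrow> 'o \<Rightarrow> 'm set"
  ident :: "'o \<Rightarrow> 'm"
  cmp :: "'m \<Rightarrow> 'm \<Rightarrow> 'm" (infixl \<open>\<cdot>\<index>\<close> 70)
  scl :: "'k \<Rightarrow> 'm \<Rightarrow> 'm"

locale linear_category =
  fixes C :: "('k::field, 'o, 'm::ab_group_add, 'z) linear_cat_scheme" (structure)
  assumes vec: "vector_space (scl C)"
    and Mor_subspace: "\<lbrakk>A \<in> Ob C; B \<in> Ob C\<rbrakk> \<Longrightarrow> module.subspace (scl C) (Mor C A B)"
    and ident_in: "A \<in> Ob C \<Longrightarrow> ident C A \<in> Mor C A A"
    and cmp_in: "\<lbrakk>A \<in> Ob C; B \<in> Ob C; D \<in> Ob C; f \<in> Mor C A B; g \<in> Mor C B D\<rbrakk>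
                  \<Longrightarrow> g \<cdot> f \<in> Mor C A D"
    and cmp_ident: "\<lbrakk>A \<in> Ob C; B \<in> Ob C; f \<in> Mor C A B\<rbrakk>
                  \<Longrightarrow> f \<cdot> ident C A = f \<and> ident C B \<cdot> f = f"
    and cmp_assoc: "\<lbrakk>A \<in> Ob C; B \<in> Ob C; D \<in> Ob C; E \<in> Ob C;
                  f \<in> Mor C A B; g \<in> Mor C B D; h \<in> Mor C D E\<rbrakk>
                  \<Longrightarrow> (h \<cdot> g) \<cdot> f = h \<cdot> (g \<cdot> f)"
    and cmp_add_right: "\<lbrakk>A \<in> Ob C; B \<in> Ob C; D \<in> Ob C;
                  f \<in> Mor C A B; f' \<in> Mor C A B; g \<in> Mor C B D\<rbrakk>
                  \<Longrightarrow> g \<cdot> (f + f') = g \<cdot> f + g \<cdot> f'"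
    and cmp_add_left: "\<lbrakk>A \<in> Ob C; B \<in> Ob C; D \<in> Ob C;
                  f \<in> Mor C A B; g \<in> Mor C B D; g' \<in> Mor C B D\<rbrakk>
                  \<Longrightarrow> (g + g') \<cdot> f = g \<cdot> f + g' \<cdot> f"
    and cmp_scale: "\<lbrakk>A \<in> Ob C; B \<in> Ob C; D \<in> Ob C; f \<in> Mor C A B; g \<in> Mor C B D\<rbrakk>
                  \<Longrightarrow> g \<cdot> scl C c f = scl C c (g \<cdot> f) \<and> scl C c g \<cdot> f = scl C c (g \<cdot> f)"

context
  fixes C :: "('k::field, 'o, 'm::ab_group_add, 'z) linear_cat_scheme" (structure)
begin

definition inverse_mor :: "'o \<Rightarrow> 'o \<Rightarrow> 'm \<Rightarrow> 'm \<Rightarrow> bool" where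
  "inverse_mor A B f g \<longleftrightarrow>
     f \<in> Mor C A B \<and> g \<in> Mor C B A \<and> g \<cdot> f = ident C A \<and> f \<cdot> g = ident C B"

definition iso_mor :: "'o \<Rightarrow> 'o \<Rightarrow> 'm \<Rightarrow> bool" where
  "iso_mor A B f \<longleftrightarrow> (\<exists>g. inverse_mor A B f g)"

definition inv_mor :: "'o \<Rightarrow> 'o \<Rightarrow> 'm \<Rightarrow> 'm" where
  "inv_mor A B f = (THE g. inverse_mor A B f g)"

definition isomorphic :: "'o \<Rightarrow> 'o \<Rightarrow> bool" where
  "isomorphic A B \<longleftrightarrow> A \<in> Ob C \<and> B \<in> Ob C \<and> (\<exists>f. iso_mor A B f)"

definition zero_object :: "'o \<Rightarrow> bool" where
  "zero_object Z \<longleftrightarrow> Z \<in> Ob C \<and> (\<forall>A\<in>Ob C. Mor C Z A = {0} \<and> Mor C A Z = {0})"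

definition mono_mor :: "'o \<Rightarrow> 'o \<Rightarrow> 'm \<Rightarrow> bool" where
  "mono_mor A B f \<longleftrightarrow> f \<in> Mor C A B \<and>
     (\<forall>T\<in>Ob C. \<forall>u\<in>Mor C T A. \<forall>v\<in>Mor C T A. f \<cdot> u = f \<cdot> v \<longrightarrow> u = v)"

definition epi_mor :: "'o \<Rightarrow> 'o \<Rightarrow> 'm \<Rightarrow> bool" where
  "epi_mor A B f \<longleftrightarrow> f \<in> Mor C A B \<and>
     (\<forall>T\<in>Ob C. \<forall>u\<in>Mor C B T. \<forall>v\<in>Mor C B T. u \<cdot> f = v \<cdot> f \<longrightarrow> u = v)"

text \<open>\<open>k : K \<rightarrow> A\<close> is a kernel of \<open>f : A \<rightarrow> B\<close>; dually, \<open>q : B \<rightarrow> Q\<close> is a cokernel of \<open>f\<close>.\<close>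

definition is_kernel :: "'o \<Rightarrow> 'o \<Rightarrow> 'm \<Rightarrow> 'o \<Rightarrow> 'm \<Rightarrow> bool" where
  "is_kernel A B f K k \<longleftrightarrow> K \<in> Ob C \<and> k \<in> Mor C K A \<and> f \<cdot> k = 0 \<and>
     (\<forall>T\<in>Ob C. \<forall>t\<in>Mor C T A. f \<cdot> t = 0 \<longrightarrow> (\<exists>!u. u \<in> Mor C T K \<and> k \<cdot> u = t))"

definition is_cokernel :: "'o \<Rightarrow> 'o \<Rightarrow> 'm \<Rightarrow> 'o \<Rightarrow> 'm \<Rightarrow> bool" where
  "is_cokernel A B f Q q \<longleftrightarrow> Q \<in> Ob C \<and> q \<in> Mor C B Q \<and> q \<cdot> f = 0 \<and>
     (\<forall>T\<in>Ob C. \<forall>t\<in>Mor C B T. t \<cdot> f = 0 \<longrightarrow> (\<exists>!u. u \<in> Mor C Q T \<and> u \<cdot> q = t))"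

text \<open>\<open>X\<close> is a direct sum of the finite family \<open>(F a)\<^sub>a\<^sub>\<in>\<^sub>I\<close>; for empty \<open>I\<close>, \<open>X\<close> is a zero object.\<close>

definition is_direct_sum :: "'i set \<Rightarrow> ('i \<Rightarrow> 'o) \<Rightarrow> 'o \<Rightarrow> bool" where
  "is_direct_sum I F X \<longleftrightarrow> finite I \<and> F ` I \<subseteq> Ob C \<and> X \<in> Ob C \<and>
     (\<exists>i p. (\<forall>a\<in>I. i a \<in> Mor C (F a) X \<and> p a \<in> Mor C X (F a)) \<and>
            (\<forall>a\<in>I. \<forall>b\<in>I. p a \<cdot> i b = (if a = b then ident C (F a) else 0)) \<and>
            (\<Sum>a\<in>I. i a \<cdot> p a) = ident C X)"

definition direct_sums :: "'o set \<Rightarrow> 'o set" where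
  "direct_sums S = {X. \<exists>n (F :: nat \<Rightarrow> 'o). F ` {..<n} \<subseteq> S \<and> is_direct_sum {..<n} F X}"

definition simple_object :: "'o \<Rightarrow> bool" where
  "simple_object X \<longleftrightarrow> X \<in> Ob C \<and> \<not> zero_object X \<and>
     (\<forall>Y\<in>Ob C. \<forall>f. mono_mor Y X f \<longrightarrow> zero_object Y \<or> iso_mor Y X f)"

definition multiplicity_of :: "'o \<Rightarrow> 'o \<Rightarrow> nat" where
  "multiplicity_of S X = vector_space.dim (scl C) (Mor C S X)"

text \<open>
  Full abelian subcategories are taken to be replete, which follows from closure under direct
  sums (of one summand).
\<close>

definition full_abelian_subcategory :: "'o set \<Rightarrow> bool" where
  "full_abelian_subcategory D \<longleftrightarrow> D \<subseteq> Ob C \<and> direct_sums D \<subseteq> D \<and>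
     (\<forall>A\<in>D. \<forall>B\<in>D. \<forall>f\<in>Mor C A B.
        (\<forall>K k. is_kernel A B f K k \<longrightarrow> K \<in> D) \<and> (\<forall>Q q. is_cokernel A B f Q q \<longrightarrow> Q \<in> D))"

end

locale linear_abelian_category = linear_category +
  assumes direct_sum_ex: "\<And>n (F :: nat \<Rightarrow> _). F ` {..<n} \<subseteq> Ob C \<Longrightarrow> \<exists>X. is_direct_sum C {..<n} F X"
    and kernel_ex: "\<lbrakk>A \<in> Ob C; B \<in> Ob C; f \<in> Mor C A B\<rbrakk> \<Longrightarrow> \<exists>K k. is_kernel C A B f K k"
    and cokernel_ex: "\<lbrakk>A \<in> Ob C; B \<in> Ob C; f \<in> Mor C A B\<rbrakk> \<Longrightarrow> \<exists>Q q. is_cokernel C A B f Q q"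
    and mono_normal: "\<lbrakk>A \<in> Ob C; B \<in> Ob C; mono_mor C A B f\<rbrakk>
                  \<Longrightarrow> \<exists>D\<in>Ob C. \<exists>g\<in>Mor C B D. is_kernel C B D g A f"
    and epi_normal: "\<lbrakk>A \<in> Ob C; B \<in> Ob C; epi_mor C A B f\<rbrakk>
                  \<Longrightarrow> \<exists>D\<in>Ob C. \<exists>g\<in>Mor C D A. is_cokernel C D A g B f"

section \<open>Braided fusion categories\<close>

text \<open>
  \<open>assoc A B D : (A \<boxtimes> B) \<boxtimes> D \<rightarrow> A \<boxtimes> (B \<boxtimes> D)\<close>, \<open>lunit A : 1 \<boxtimes> A \<rightarrow> A\<close>,
  \<open>runit A : A \<boxtimes> 1 \<rightarrow> A\<close>; \<open>\<boxtimes>\<close> is the tensor product of objects and \<open>\<star>\<close> that of morphisms.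
\<close>

record ('k, 'o, 'm) monoidal_cat = "('k, 'o, 'm) linear_cat" +
  tens :: "'o \<Rightarrow> 'o \<Rightarrow> 'o" (infixl \<open>\<boxtimes>\<index>\<close> 75)
  tens_mor :: "'m \<Rightarrow> 'm \<Rightarrow> 'm" (infixl \<open>\<star>\<index>\<close> 75)
  unit :: "'o"
  assoc :: "'o \<Rightarrow> 'o \<Rightarrow> 'o \<Rightarrow> 'm"
  lunit :: "'o \<Rightarrow> 'm"
  runit :: "'o \<Rightarrow> 'm"

locale linear_monoidal_category = linear_abelian_category C
  for C :: "('k::field, 'o, 'm::ab_group_add, 'z) monoidal_cat_scheme" (structure) +
  assumes tens_Ob: "\<lbrakk>A \<in> Ob C; B \<in> Ob C\<rbrakk> \<Longrightarrow> A \<boxtimes> B \<in> Ob C"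
    and unit_Ob: "unit C \<in> Ob C"
    and tens_mor_in: "\<lbrakk>A \<in> Ob C; B \<in> Ob C; A' \<in> Ob C; B' \<in> Ob C; f \<in> Mor C A B; g \<in> Mor C A' B'\<rbrakk>
                  \<Longrightarrow> f \<star> g \<in> Mor C (A \<boxtimes> A') (B \<boxtimes> B')"
    and tens_ident: "\<lbrakk>A \<in> Ob C; B \<in> Ob C\<rbrakk> \<Longrightarrow> ident C A \<star> ident C B = ident C (A \<boxtimes> B)"
    and tens_cmp: "\<lbrakk>A \<in> Ob C; B \<in> Ob C; D \<in> Ob C; A' \<in> Ob C; B' \<in> Ob C; D' \<in> Ob C;
                  f \<in> Mor C A B; g \<in> Mor C B D; f' \<in> Mor C A' B'; g' \<in> Mor C B' D'\<rbrakk>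
                  \<Longrightarrow> (g \<cdot> f) \<star> (g' \<cdot> f') = (g \<star> g') \<cdot> (f \<star> f')"
    and tens_add_left: "\<lbrakk>A \<in> Ob C; B \<in> Ob C; A' \<in> Ob C; B' \<in> Ob C;
                  f \<in> Mor C A B; g \<in> Mor C A B; h \<in> Mor C A' B'\<rbrakk>
                  \<Longrightarrow> (f + g) \<star> h = f \<star> h + g \<star> h"
    and tens_add_right: "\<lbrakk>A \<in> Ob C; B \<in> Ob C; A' \<in> Ob C; B' \<in> Ob C;
                  f \<in> Mor C A B; g \<in> Mor C A' B'; h \<in> Mor C A' B'\<rbrakk>
                  \<Longrightarrow> f \<star> (g + h) = f \<star> g + f \<star> h"
    and tens_scale: "\<lbrakk>A \<in> Ob C; B \<in> Ob C; A' \<in> Ob C; B' \<in> Ob C; f \<in> Mor C A B; g \<in> Mor C A' B'\<rbrakk>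
                  \<Longrightarrow> scl C c f \<star> g = scl C c (f \<star> g) \<and> f \<star> scl C c g = scl C c (f \<star> g)"
    and assoc_iso: "\<lbrakk>A \<in> Ob C; B \<in> Ob C; D \<in> Ob C\<rbrakk>
                  \<Longrightarrow> iso_mor C ((A \<boxtimes> B) \<boxtimes> D) (A \<boxtimes> (B \<boxtimes> D)) (assoc C A B D)"
    and lunit_iso: "A \<in> Ob C \<Longrightarrow> iso_mor C (unit C \<boxtimes> A) A (lunit C A)"
    and runit_iso: "A \<in> Ob C \<Longrightarrow> iso_mor C (A \<boxtimes> unit C) A (runit C A)"
    and assoc_natural: "\<lbrakk>A \<in> Ob C; B \<in> Ob C; D \<in> Ob C; A' \<in> Ob C; B' \<in> Ob C; D' \<in> Ob C;
                  f \<in> Mor C A A'; g \<in> Mor C B B'; h \<in> Mor C D D'\<rbrakk>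
                  \<Longrightarrow> assoc C A' B' D' \<cdot> ((f \<star> g) \<star> h) = (f \<star> (g \<star> h)) \<cdot> assoc C A B D"
    and lunit_natural: "\<lbrakk>A \<in> Ob C; B \<in> Ob C; f \<in> Mor C A B\<rbrakk>
                  \<Longrightarrow> lunit C B \<cdot> (ident C (unit C) \<star> f) = f \<cdot> lunit C A"
    and runit_natural: "\<lbrakk>A \<in> Ob C; B \<in> Ob C; f \<in> Mor C A B\<rbrakk>
                  \<Longrightarrow> runit C B \<cdot> (f \<star> ident C (unit C)) = f \<cdot> runit C A"
    and pentagon: "\<lbrakk>A \<in> Ob C; B \<in> Ob C; D \<in> Ob C; E \<in> Ob C\<rbrakk>
                  \<Longrightarrow> assoc C A B (D \<boxtimes> E) \<cdot> assoc C (A \<boxtimes> B) D E =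
                      (ident C A \<star> assoc C B D E) \<cdot> assoc C A (B \<boxtimes> D) E
                        \<cdot> (assoc C A B D \<star> ident C E)"
    and triangle: "\<lbrakk>A \<in> Ob C; B \<in> Ob C\<rbrakk>
                  \<Longrightarrow> (ident C A \<star> lunit C B) \<cdot> assoc C A (unit C) B = runit C A \<star> ident C B"

context
  fixes C :: "('k::field, 'o, 'm::ab_group_add, 'z) monoidal_cat_scheme" (structure)
begin

text \<open>
  \<open>Y\<close> is a (left) dual \<open>X*\<close> of \<open>X\<close>, with evaluation \<open>Y \<boxtimes> X \<rightarrow> 1\<close> and coevaluation
  \<open>1 \<rightarrow> X \<boxtimes> Y\<close>. Duals are unique up to isomorphism, so below \<open>X*\<close> stands for any such \<open>Y\<close>.
\<close>

definition is_dual :: "'o \<Rightarrow> 'o \<Rightarrow> bool" where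
  "is_dual X Y \<longleftrightarrow> X \<in> Ob C \<and> Y \<in> Ob C \<and>
     (\<exists>ev\<in>Mor C (Y \<boxtimes> X) (unit C). \<exists>coev\<in>Mor C (unit C) (X \<boxtimes> Y).
        runit C X \<cdot> (ident C X \<star> ev) \<cdot> assoc C X Y X \<cdot> (coev \<star> ident C X) = lunit C X \<and>
        lunit C Y \<cdot> (ev \<star> ident C Y) \<cdot> inv_mor C ((Y \<boxtimes> X) \<boxtimes> Y) (Y \<boxtimes> (X \<boxtimes> Y)) (assoc C Y X Y)
          \<cdot> (ident C Y \<star> coev) = runit C Y)"

definition self_dual :: "'o \<Rightarrow> bool" where
  "self_dual X \<longleftrightarrow> (\<exists>Y. is_dual X Y \<and> isomorphic C X Y)"

primrec tens_pow :: "'o \<Rightarrow> nat \<Rightarrow> 'o" where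
  "tens_pow X 0 = unit C"
| "tens_pow X (Suc n) = tens_pow X n \<boxtimes> X"

text \<open>
  In a fusion category every nonzero object has an order; the value \<open>0\<close> for the remaining case
  follows the convention of \<open>group.ord\<close>.
\<close>

definition object_order :: "'o \<Rightarrow> nat" where
  "object_order X =
     (if \<exists>n\<ge>1. multiplicity_of C (unit C) (tens_pow X n) > 0
      then LEAST n. n \<ge> 1 \<and> multiplicity_of C (unit C) (tens_pow X n) > 0 else 0)"

definition fusion_subcategory :: "'o set \<Rightarrow> bool" where
  "fusion_subcategory D \<longleftrightarrow> D \<subseteq> Ob C \<and> unit C \<in> D \<and> (\<forall>X\<in>D. \<forall>Y\<in>D. X \<boxtimes> Y \<in> D) \<and>
     direct_sums C D \<subseteq> D \<and> (\<forall>X\<in>D. \<forall>Y\<in>Ob C. \<forall>f. mono_mor C Y X f \<longrightarrow> Y \<in> D)"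

definition generated_subcategory :: "'o set \<Rightarrow> 'o set" where
  "generated_subcategory S = \<Inter> {D. fusion_subcategory D \<and> S \<subseteq> D}"

definition adjoint_subcategory :: "'o set" where
  "adjoint_subcategory = generated_subcategory {X \<boxtimes> Y |X Y. simple_object C X \<and> is_dual X Y}"

end

locale fusion_category = linear_monoidal_category C
  for C :: "('k::{alg_closed_field, field_char_0}, 'o, 'm::ab_group_add, 'z) monoidal_cat_scheme"
    (structure) +
  assumes left_dual_ex: "X \<in> Ob C \<Longrightarrow> \<exists>Y. is_dual C X Y"
    and right_dual_ex: "X \<in> Ob C \<Longrightarrow> \<exists>Y. is_dual C Y X"
    and semisimple: "Ob C \<subseteq> direct_sums C {X. simple_object C X}"
    and finitely_many_simples:
      "\<exists>S. finite S \<and> (\<forall>X. simple_object C X \<longrightarrow> (\<exists>Y\<in>S. isomorphic C X Y))"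
    and finite_dim: "\<lbrakk>A \<in> Ob C; B \<in> Ob C\<rbrakk> \<Longrightarrow> \<exists>F. finite F \<and> Mor C A B = module.span (scl C) F"
    and unit_simple: "simple_object C (unit C)"

text \<open>\<open>braid A B : A \<boxtimes> B \<rightarrow> B \<boxtimes> A\<close>\<close>

record ('k, 'o, 'm) braided_cat = "('k, 'o, 'm) monoidal_cat" +
  braid :: "'o \<Rightarrow> 'o \<Rightarrow> 'm"

locale braided_fusion_category = fusion_category C
  for C :: "('k::{alg_closed_field, field_char_0}, 'o, 'm::ab_group_add, 'z) braided_cat_scheme"
    (structure) +
  assumes braid_iso: "\<lbrakk>A \<in> Ob C; B \<in> Ob C\<rbrakk> \<Longrightarrow> iso_mor C (A \<boxtimes> B) (B \<boxtimes> A) (braid C A B)"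
    and braid_natural: "\<lbrakk>A \<in> Ob C; B \<in> Ob C; A' \<in> Ob C; B' \<in> Ob C;
                  f \<in> Mor C A A'; g \<in> Mor C B B'\<rbrakk>
                  \<Longrightarrow> braid C A' B' \<cdot> (f \<star> g) = (g \<star> f) \<cdot> braid C A B"
    and hexagon1: "\<lbrakk>A \<in> Ob C; B \<in> Ob C; D \<in> Ob C\<rbrakk>
                  \<Longrightarrow> assoc C B D A \<cdot> braid C A (B \<boxtimes> D) \<cdot> assoc C A B D =
                      (ident C B \<star> braid C A D) \<cdot> assoc C B A D \<cdot> (braid C A B \<star> ident C D)"
    and hexagon2: "\<lbrakk>A \<in> Ob C; B \<in> Ob C; D \<in> Ob C\<rbrakk>
                  \<Longrightarrow> inv_mor C ((D \<boxtimes> A) \<boxtimes> B) (D \<boxtimes> (A \<boxtimes> B)) (assoc C D A B)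
                        \<cdot> braid C (A \<boxtimes> B) D
                        \<cdot> inv_mor C ((A \<boxtimes> B) \<boxtimes> D) (A \<boxtimes> (B \<boxtimes> D)) (assoc C A B D) =
                      (braid C A D \<star> ident C B)
                        \<cdot> inv_mor C ((A \<boxtimes> D) \<boxtimes> B) (A \<boxtimes> (D \<boxtimes> B)) (assoc C A D B)
                        \<cdot> (ident C A \<star> braid C B D)"

section \<open>Gradings\<close>

definition grading ::
    "('k::field, 'o, 'm::ab_group_add, 'z) monoidal_cat_scheme \<Rightarrow> 'g monoid \<Rightarrow> ('g \<Rightarrow> 'o set) \<Rightarrow> bool"
  where
  "grading C G D \<longleftrightarrow> group G \<and>
     (\<forall>g\<in>carrier G. full_abelian_subcategory C (D g)) \<and>
     Ob C = direct_sums C (\<Union>g\<in>carrier G. D g) \<and>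
     (\<forall>g\<in>carrier G. \<forall>h\<in>carrier G. g \<noteq> h \<longrightarrow> (\<forall>X\<in>D g. \<forall>Y\<in>D h. Mor C X Y = {0})) \<and>
     (\<forall>g\<in>carrier G. {Y. \<exists>X\<in>D g. is_dual C X Y} = D (inv\<^bsub>G\<^esub> g)) \<and>
     (\<forall>g\<in>carrier G. \<forall>h\<in>carrier G. \<forall>X\<in>D g. \<forall>Y\<in>D h. X \<boxtimes>\<^bsub>C\<^esub> Y \<in> D (g \<otimes>\<^bsub>G\<^esub> h))"

definition faithful_grading ::
    "('k::field, 'o, 'm::ab_group_add, 'z) monoidal_cat_scheme \<Rightarrow> 'g monoid \<Rightarrow> ('g \<Rightarrow> 'o set) \<Rightarrow> bool"
  where
  "faithful_grading C G D \<longleftrightarrow> grading C G D \<and> (\<forall>g\<in>carrier G. \<exists>X\<in>D g. \<not> zero_object C X)"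

definition pushforward_grading ::
    "('k::field, 'o, 'm::ab_group_add, 'z) monoidal_cat_scheme \<Rightarrow> 'u monoid \<Rightarrow> ('u \<Rightarrow> 'o set)
       \<Rightarrow> ('u \<Rightarrow> 'g) \<Rightarrow> 'g \<Rightarrow> 'o set"
  where
  "pushforward_grading C U D \<phi> g = direct_sums C (\<Union>u\<in>{u \<in> carrier U. \<phi> u = g}. D u)"

text \<open>
  \<open>U\<close> is the universal grading group of \<open>C\<close>, and \<open>D\<close> the universal grading. HOL cannot quantify
  over all types inside a definition, so the universal property ranges over groups with carrier
  in \<open>nat\<close>. For a fusion category nothing is lost: the elements \<open>g\<close> with nonzero component in a
  grading by any group form a finite subgroup, which has an isomorphic copy on \<open>nat\<close>, and every
  homomorphism inducing the grading lands in that subgroup because \<open>D\<close> is faithful.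
\<close>

definition universal_grading ::
    "('k::field, 'o, 'm::ab_group_add, 'z) monoidal_cat_scheme \<Rightarrow> 'u monoid \<Rightarrow> ('u \<Rightarrow> 'o set) \<Rightarrow> bool"
  where
  "universal_grading C U D \<longleftrightarrow> faithful_grading C U D \<and>
     D \<one>\<^bsub>U\<^esub> = adjoint_subcategory C \<and>
     (\<forall>(G :: nat monoid) E. grading C G E \<longrightarrow>
        (\<exists>!\<phi>. \<phi> \<in> hom U G \<and> \<phi> \<in> extensional (carrier U) \<and>
              (\<forall>g\<in>carrier G. E g = pushforward_grading C U D \<phi> g)))"

section \<open>Exponents\<close>

text \<open>The exponent is \<open>0\<close> if no positive power annihilates \<open>G\<close>.\<close>

definition group_exponent :: "('a, 'b) monoid_scheme \<Rightarrow> nat" where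
  "group_exponent G =
     (if \<exists>n\<ge>1. \<forall>x\<in>carrier G. x [^]\<^bsub>G\<^esub> (n::nat) = \<one>\<^bsub>G\<^esub>
      then LEAST n. n \<ge> 1 \<and> (\<forall>x\<in>carrier G. x [^]\<^bsub>G\<^esub> n = \<one>\<^bsub>G\<^esub>) else 0)"

definition elementary_abelian_2_group :: "('a, 'b) monoid_scheme \<Rightarrow> bool" where
  "elementary_abelian_2_group G \<longleftrightarrow>
     comm_group G \<and> (\<forall>x\<in>carrier G. x \<otimes>\<^bsub>G\<^esub> x = \<one>\<^bsub>G\<^esub>)"

end

theory Submission
  imports Defs "HOL-Algebra.Multiplicative_Group"
begin

text \<open>
  Everything is read off from the degrees of simple objects in a faithful grading of \<open>\<C>\<close> by \<open>U\<close>.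

  The braiding makes \<open>U\<close> abelian: for nonzero \<open>X \<in> \<C>\<^sub>g\<close> and \<open>Y \<in> \<C>\<^sub>h\<close> the object \<open>X \<otimes> Y \<simeq> Y \<otimes> X\<close>
  is nonzero and lies in both \<open>\<C>\<^sub>g\<^sub>h\<close> and \<open>\<C>\<^sub>h\<^sub>g\<close>, so \<open>gh = hg\<close> (lemma
  \<open>comm_group_of_faithful_grading\<close>). That \<open>X \<otimes> Y\<close> is nonzero follows from rigidity and
  semisimplicity: the coevaluation exhibits \<open>1\<close> as a summand of \<open>Y \<otimes> Y*\<close>, hence \<open>X\<close> as a summand
  of \<open>(X \<otimes> Y) \<otimes> Y*\<close> (lemma \<open>tens_nonzero\<close>).

  A simple object \<open>X\<close> is homogeneous, of degree \<open>g\<close> say. If \<open>1\<close> occurs in the \<open>n\<close>-th tensor power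
  of \<open>X\<close>, comparing degrees gives \<open>g\<^sup>n = 1\<close> (lemma \<open>degree_pow_object_order\<close>); if \<open>X \<simeq> X*\<close>, it
  gives \<open>g = g\<^sup>-\<^sup>1\<close> (lemma \<open>degree_self_dual\<close>).

  Finally, the degrees of the generators determine all degrees. For a submonoid \<open>H\<close> of \<open>U\<close>, the
  objects whose homogeneous components all have degree in \<open>H\<close> form a fusion subcategory. If it
  contains the generators it is all of \<open>\<C>\<close>, and then \<open>H = U\<close> because the grading is faithful
  (lemma \<open>degrees_of_generators\<close>). In an abelian group the \<open>N\<close>-torsion elements form such an
  \<open>H\<close>; the two claims are the cases where \<open>N\<close> is the least common multiple of the orders and
  \<open>N = 2\<close>.
\<close>

section \<open>Linear categories\<close>

context linear_category
begin

lemma zero_in_Mor: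
  assumes "A \<in> Ob C" "B \<in> Ob C"
  shows "0 \<in> Mor C A B"
proof -
  interpret vector_space "scl C" by (rule vec)
  show ?thesis using Mor_subspace[OF assms] by (rule subspace_0)
qed

lemma add_in_Mor:
  assumes "A \<in> Ob C" "B \<in> Ob C" "f \<in> Mor C A B" "g \<in> Mor C A B"
  shows "f + g \<in> Mor C A B"
proof -
  interpret vector_space "scl C" by (rule vec)
  show ?thesis using subspace_add[OF Mor_subspace[OF assms(1,2)]] assms(3,4) by blast
qed

lemma diff_in_Mor:
  assumes "A \<in> Ob C" "B \<in> Ob C" "f \<in> Mor C A B" "g \<in> Mor C A B"
  shows "f - g \<in> Mor C A B"
proof -
  interpret vector_space "scl C" by (rule vec)
  show ?thesis using subspace_diff[OF Mor_subspace[OF assms(1,2)]] assms(3,4) by blast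
qed

lemma sum_in_Mor:
  assumes "A \<in> Ob C" "B \<in> Ob C" "\<And>a. a \<in> I \<Longrightarrow> f a \<in> Mor C A B"
  shows "(\<Sum>a\<in>I. f a) \<in> Mor C A B"
  using assms(3) by (induction I rule: infinite_finite_induct)
    (auto intro: zero_in_Mor add_in_Mor assms(1,2))

lemma cmp_zero_right:
  assumes "A \<in> Ob C" "B \<in> Ob C" "D \<in> Ob C" "g \<in> Mor C B D"
  shows "g \<cdot> 0 = 0"
  using cmp_add_right[OF assms(1-3) zero_in_Mor zero_in_Mor assms(4)] assms by simp

lemma cmp_zero_left:
  assumes "A \<in> Ob C" "B \<in> Ob C" "D \<in> Ob C" "f \<in> Mor C A B"
  shows "0 \<cdot> f = 0"
  using cmp_add_left[OF assms(1-4) zero_in_Mor zero_in_Mor] assms by simp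

lemma cmp_diff_right:
  assumes "A \<in> Ob C" "B \<in> Ob C" "D \<in> Ob C" "f \<in> Mor C A B" "f' \<in> Mor C A B" "g \<in> Mor C B D"
  shows "g \<cdot> (f - f') = g \<cdot> f - g \<cdot> f'"
  using cmp_add_right[OF assms(1-3) diff_in_Mor[OF assms(1,2,4,5)] assms(5,6)]
  by (simp add: algebra_simps)

lemma cmp_sum_left:
  assumes "A \<in> Ob C" "B \<in> Ob C" "D \<in> Ob C" "f \<in> Mor C A B" "\<And>a. a \<in> I \<Longrightarrow> g a \<in> Mor C B D"
  shows "(\<Sum>a\<in>I. g a) \<cdot> f = (\<Sum>a\<in>I. g a \<cdot> f)"
  using assms(5)
proof (induction I rule: infinite_finite_induct)
  case (insert a I)
  have "g a \<in> Mor C B D" "(\<Sum>a\<in>I. g a) \<in> Mor C B D"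
    using insert.prems sum_in_Mor[OF assms(2,3), of I g] by auto
  then show ?case using insert cmp_add_left[OF assms(1-4)] by simp
qed (use cmp_zero_left[OF assms(1-4)] in auto)

lemma zero_object_iff_ident:
  assumes "A \<in> Ob C"
  shows "zero_object C A \<longleftrightarrow> ident C A = 0"
proof
  assume "zero_object C A"
  then show "ident C A = 0" using ident_in[OF assms] assms unfolding zero_object_def by auto
next
  assume z: "ident C A = 0"
  have "f = 0" if "B \<in> Ob C" "f \<in> Mor C A B" for f B
    using cmp_ident[OF assms that] cmp_zero_right[OF assms assms that] z by simp
  moreover have "f = 0" if "B \<in> Ob C" "f \<in> Mor C B A" for f B
    using cmp_ident[OF that(1) assms that(2)] cmp_zero_left[OF that(1) assms assms that(2)] z by simp
  ultimately show "zero_object C A"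
    unfolding zero_object_def using assms zero_in_Mor by blast
qed

lemma direct_sumE:
  assumes "is_direct_sum C I F X"
  obtains i p where "X \<in> Ob C" "\<And>a. a \<in> I \<Longrightarrow> F a \<in> Ob C"
    "\<And>a. a \<in> I \<Longrightarrow> i a \<in> Mor C (F a) X" "\<And>a. a \<in> I \<Longrightarrow> p a \<in> Mor C X (F a)"
    "\<And>a b. a \<in> I \<Longrightarrow> b \<in> I \<Longrightarrow> p a \<cdot> i b = (if a = b then ident C (F a) else 0)"
    "(\<Sum>a\<in>I. i a \<cdot> p a) = ident C X"
proof -
  obtain i p where "\<forall>a\<in>I. i a \<in> Mor C (F a) X \<and> p a \<in> Mor C X (F a)"
    "\<forall>a\<in>I. \<forall>b\<in>I. p a \<cdot> i b = (if a = b then ident C (F a) else 0)"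
    "(\<Sum>a\<in>I. i a \<cdot> p a) = ident C X"
    using assms unfolding is_direct_sum_def by blast
  moreover have "X \<in> Ob C" "\<forall>a\<in>I. F a \<in> Ob C"
    using assms unfolding is_direct_sum_def by auto
  ultimately show thesis by (intro that[of i p]) simp_all
qed

text \<open>Morphisms into a direct sum are determined by their components.\<close>

lemma direct_sum_eq_zeroI:
  assumes "X \<in> Ob C" "T \<in> Ob C" "t \<in> Mor C T X"
    and "\<And>a. a \<in> I \<Longrightarrow> F a \<in> Ob C"
    and "\<And>a. a \<in> I \<Longrightarrow> i a \<in> Mor C (F a) X" "\<And>a. a \<in> I \<Longrightarrow> p a \<in> Mor C X (F a)"
    and "(\<Sum>a\<in>I. i a \<cdot> p a) = ident C X"
    and zero: "\<And>a. a \<in> I \<Longrightarrow> i a = 0 \<or> p a \<cdot> t = 0"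
  shows "t = 0"
proof -
  have ip: "i a \<cdot> p a \<in> Mor C X X" if "a \<in> I" for a
    using cmp_in[of X "F a" X "p a" "i a"] assms(1,4-6) that by simp
  have "t = (\<Sum>a\<in>I. i a \<cdot> p a) \<cdot> t" using cmp_ident[of T X t] assms(1-3,7) by simp
  also have "\<dots> = (\<Sum>a\<in>I. (i a \<cdot> p a) \<cdot> t)"
    by (rule cmp_sum_left[OF assms(2,1,1,3) ip])
  also have "\<dots> = (\<Sum>a\<in>I. i a \<cdot> (p a \<cdot> t))"
    using cmp_assoc[OF assms(2,1) assms(4) assms(1,3) assms(6) assms(5)] by (intro sum.cong refl)
  also have "\<dots> = 0"
  proof (intro sum.neutral ballI)
    fix a assume a: "a \<in> I"
    have "p a \<cdot> t \<in> Mor C T (F a)" using cmp_in[of T X "F a" t "p a"] a assms(1-6) by simp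
    then show "i a \<cdot> (p a \<cdot> t) = 0"
      using zero[OF a] cmp_zero_left[of T "F a" X "p a \<cdot> t"] cmp_zero_right[of T "F a" X "i a"]
        a assms(1,2,4-6) by auto
  qed
  finally show ?thesis .
qed

lemma split_mono:
  assumes "A \<in> Ob C" "X \<in> Ob C" "i \<in> Mor C A X" "p \<in> Mor C X A" "p \<cdot> i = ident C A"
  shows "mono_mor C A X i"
  unfolding mono_mor_def
proof (intro conjI ballI impI assms(3))
  fix T u v assume T: "T \<in> Ob C" "u \<in> Mor C T A" "v \<in> Mor C T A" and eq: "i \<cdot> u = i \<cdot> v"
  have "u = p \<cdot> (i \<cdot> u)" using cmp_assoc[of T A X A u i p] cmp_ident[of T A u] T assms by simp
  also have "\<dots> = v" using eq cmp_assoc[of T A X A v i p] cmp_ident[of T A v] T assms by simp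
  finally show "u = v" .
qed

lemma isomorphic_sym: "isomorphic C A B \<Longrightarrow> isomorphic C B A"
  unfolding isomorphic_def iso_mor_def inverse_mor_def by blast

lemma direct_sums_replete:
  assumes "isomorphic C A B" "A \<in> S"
  shows "B \<in> direct_sums C S"
proof -
  obtain f g where "A \<in> Ob C" "B \<in> Ob C" "f \<in> Mor C A B" "g \<in> Mor C B A"
    "g \<cdot> f = ident C A" "f \<cdot> g = ident C B"
    using assms(1) unfolding isomorphic_def iso_mor_def inverse_mor_def by blast
  then have "is_direct_sum C {..<1::nat} (\<lambda>_. A) B"
    unfolding is_direct_sum_def
    by (intro conjI exI[of _ "\<lambda>_. f"] exI[of _ "\<lambda>_. g"]) auto
  then show ?thesis unfolding direct_sums_def using assms(2)
    by (intro CollectI exI[of _ 1] exI[of _ "\<lambda>_. A"]) auto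
qed

lemma simple_ident_nonzero:
  assumes "simple_object C X"
  shows "X \<in> Ob C" "ident C X \<noteq> 0"
  using assms zero_object_iff_ident unfolding simple_object_def by auto

text \<open>A simple object is indecomposable: the inclusion of any nonzero summand is a monomorphism,
  hence invertible.\<close>

lemma simple_in_direct_sums:
  assumes "simple_object C X" "X \<in> direct_sums C S"
  obtains A where "A \<in> S" "isomorphic C A X"
proof -
  obtain n F where F: "F ` {..<n::nat} \<subseteq> S" and ds: "is_direct_sum C {..<n} F X"
    using assms(2) unfolding direct_sums_def by blast
  obtain i p where ip: "\<And>a. a \<in> {..<n} \<Longrightarrow> F a \<in> Ob C"
    "\<And>a. a \<in> {..<n} \<Longrightarrow> i a \<in> Mor C (F a) X" "\<And>a. a \<in> {..<n} \<Longrightarrow> p a \<in> Mor C X (F a)"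
    "\<And>a b. a \<in> {..<n} \<Longrightarrow> b \<in> {..<n} \<Longrightarrow> p a \<cdot> i b = (if a = b then ident C (F a) else 0)"
    "(\<Sum>a\<in>{..<n}. i a \<cdot> p a) = ident C X"
    by (rule direct_sumE[OF ds]) blast
  have X: "X \<in> Ob C" "ident C X \<noteq> 0" using simple_ident_nonzero[OF assms(1)] by auto
  have "\<exists>a\<in>{..<n}. i a \<noteq> 0"
    using direct_sum_eq_zeroI[OF X(1) X(1) ident_in[OF X(1)] ip(1-3,5)] X(2) by blast
  then obtain a where a: "a \<in> {..<n}" "i a \<noteq> 0" by blast
  have "mono_mor C (F a) X (i a)" using split_mono[of "F a" X "i a" "p a"] ip a X by simp
  moreover have "\<not> zero_object C (F a)"
    using a ip X unfolding zero_object_def by blast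
  ultimately have "iso_mor C (F a) X (i a)"
    using assms(1) ip(1)[OF a(1)] unfolding simple_object_def by blast
  then have "isomorphic C (F a) X" unfolding isomorphic_def using ip(1)[OF a(1)] X by blast
  then show thesis using that F a by blast
qed

text \<open>Half of Schur's lemma: the kernel is a proper subobject of the simple object \<open>A\<close>, hence zero.\<close>

lemma mono_of_simple_source:
  assumes "simple_object C A" "B \<in> Ob C" "f \<in> Mor C A B" "f \<noteq> 0" "is_kernel C A B f K k"
  shows "mono_mor C A B f"
proof -
  have A: "A \<in> Ob C" using simple_ident_nonzero[OF assms(1)] by auto
  have K: "K \<in> Ob C" "k \<in> Mor C K A" "f \<cdot> k = 0"
    and univ: "\<And>T t. T \<in> Ob C \<Longrightarrow> t \<in> Mor C T A \<Longrightarrow> f \<cdot> t = 0 \<Longrightarrow> \<exists>!u. u \<in> Mor C T K \<and> k \<cdot> u = t"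
    using assms(5) unfolding is_kernel_def by auto
  have "mono_mor C K A k"
    unfolding mono_mor_def
  proof (intro conjI ballI impI K(2))
    fix T u v assume T: "T \<in> Ob C" "u \<in> Mor C T K" "v \<in> Mor C T K" and eq: "k \<cdot> u = k \<cdot> v"
    have "f \<cdot> (k \<cdot> u) = 0"
      using cmp_assoc[of T K A B u k f] cmp_zero_left[of T K B u] T K A assms by simp
    then show "u = v" using univ[OF T(1), of "k \<cdot> u"] cmp_in[of T K A] T K A eq by metis
  qed
  moreover have "\<not> iso_mor C K A k"
  proof
    assume "iso_mor C K A k"
    then obtain l where l: "l \<in> Mor C A K" "k \<cdot> l = ident C A"
      unfolding iso_mor_def inverse_mor_def by blast
    have "f = (f \<cdot> k) \<cdot> l"
      using cmp_assoc[of A K A B l k f] cmp_ident[of A B f] l K A assms by simp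
    then show False using cmp_zero_left[of A K B l] K A l assms by simp
  qed
  ultimately have "zero_object C K" using assms(1) K unfolding simple_object_def by blast
  show ?thesis
    unfolding mono_mor_def
  proof (intro conjI ballI impI assms(3))
    fix T u v assume T: "T \<in> Ob C" "u \<in> Mor C T A" "v \<in> Mor C T A" and eq: "f \<cdot> u = f \<cdot> v"
    have "u - v \<in> Mor C T A" "f \<cdot> (u - v) = 0"
      using diff_in_Mor T A cmp_diff_right[of T A B u v f] eq assms by auto
    then obtain w where "w \<in> Mor C T K" "k \<cdot> w = u - v" using univ T by blast
    moreover have "w = 0" using \<open>zero_object C K\<close> T calculation unfolding zero_object_def by blast
    ultimately show "u = v" using cmp_zero_right[of T K A k] K T A by simp
  qed
qed

lemma multiplicity_pos_nonzero_mor: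
  assumes "multiplicity_of C S X > 0"
  shows "Mor C S X \<noteq> {0}"
proof
  interpret vector_space "scl C" by (rule vec)
  assume "Mor C S X = {0}"
  then have "multiplicity_of C S X \<le> 0"
    unfolding multiplicity_of_def using dim_le_card[of "{0}" "{}"] by simp
  then show False using assms by simp
qed

end

section \<open>Tensor products of nonzero objects\<close>

context linear_monoidal_category
begin

lemma tens_zero_left:
  assumes "A \<in> Ob C" "B \<in> Ob C" "A' \<in> Ob C" "B' \<in> Ob C" "h \<in> Mor C A' B'"
  shows "0 \<star> h = 0"
  using tens_add_left[OF assms(1-4) zero_in_Mor zero_in_Mor assms(5)] assms by simp

lemma tens_zero_right:
  assumes "A \<in> Ob C" "B \<in> Ob C" "A' \<in> Ob C" "B' \<in> Ob C" "h \<in> Mor C A B"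
  shows "h \<star> 0 = 0"
  using tens_add_right[OF assms(1-5) zero_in_Mor zero_in_Mor] assms by simp

lemma sum_tens:
  assumes "A \<in> Ob C" "B \<in> Ob C" "A' \<in> Ob C" "B' \<in> Ob C"
    and "\<And>a. a \<in> I \<Longrightarrow> f a \<in> Mor C A B" "h \<in> Mor C A' B'"
  shows "(\<Sum>a\<in>I. f a) \<star> h = (\<Sum>a\<in>I. f a \<star> h)"
  using assms(5)
proof (induction I rule: infinite_finite_induct)
  case (insert a I)
  have "f a \<in> Mor C A B" "(\<Sum>a\<in>I. f a) \<in> Mor C A B"
    using insert.prems sum_in_Mor[OF assms(1,2), of I f] by auto
  then show ?case using insert tens_add_left[OF assms(1-4) _ _ assms(6)] by simp
qed (use tens_zero_left[OF assms(1-4,6)] in auto)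

lemma tens_sum:
  assumes "A \<in> Ob C" "B \<in> Ob C" "A' \<in> Ob C" "B' \<in> Ob C"
    and "\<And>a. a \<in> I \<Longrightarrow> f a \<in> Mor C A' B'" "h \<in> Mor C A B"
  shows "h \<star> (\<Sum>a\<in>I. f a) = (\<Sum>a\<in>I. h \<star> f a)"
  using assms(5)
proof (induction I rule: infinite_finite_induct)
  case (insert a I)
  have "f a \<in> Mor C A' B'" "(\<Sum>a\<in>I. f a) \<in> Mor C A' B'"
    using insert.prems sum_in_Mor[OF assms(3,4), of I f] by auto
  then show ?case using insert tens_add_right[OF assms(1-4) assms(6)] by simp
qed (use tens_zero_right[OF assms(1-4,6)] in auto)

lemma tens_pow_Ob: "X \<in> Ob C \<Longrightarrow> tens_pow C X n \<in> Ob C"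
  by (induction n) (auto intro: unit_Ob tens_Ob)

lemma isomorphic_unit_tens: "A \<in> Ob C \<Longrightarrow> isomorphic C (unit C \<boxtimes> A) A"
  unfolding isomorphic_def using lunit_iso tens_Ob unit_Ob by blast

lemma iso_mor_nonzero:
  assumes "iso_mor C A B f" "A \<in> Ob C" "B \<in> Ob C" "ident C B \<noteq> 0"
  shows "f \<noteq> 0"
proof
  assume "f = 0"
  then obtain g where "g \<in> Mor C B A" "0 \<cdot> g = ident C B"
    using assms(1) unfolding iso_mor_def inverse_mor_def by blast
  then show False using cmp_zero_left[of B A B g] assms by simp
qed

text \<open>By the zigzag identity, \<open>lunit C X\<close> factors through \<open>coev \<star> ident C X\<close>.\<close>

lemma coev_nonzero:
  assumes "X \<in> Ob C" "Y \<in> Ob C" "ident C X \<noteq> 0" "ev \<in> Mor C (Y \<boxtimes> X) (unit C)"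
    and zigzag: "runit C X \<cdot> (ident C X \<star> ev) \<cdot> assoc C X Y X \<cdot> (coev \<star> ident C X) = lunit C X"
  shows "coev \<noteq> 0"
proof
  assume z: "coev = 0"
  have obs: "X \<boxtimes> Y \<in> Ob C" "(X \<boxtimes> Y) \<boxtimes> X \<in> Ob C" "X \<boxtimes> (Y \<boxtimes> X) \<in> Ob C" "unit C \<in> Ob C"
    "X \<boxtimes> unit C \<in> Ob C" "unit C \<boxtimes> X \<in> Ob C" "Y \<boxtimes> X \<in> Ob C"
    using tens_Ob unit_Ob assms by auto
  have "coev \<star> ident C X = 0"
    using tens_zero_left[of "unit C" "X \<boxtimes> Y" X X "ident C X"] z obs assms ident_in by simp
  moreover have "runit C X \<cdot> (ident C X \<star> ev) \<cdot> assoc C X Y X \<in> Mor C ((X \<boxtimes> Y) \<boxtimes> X) X"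
  proof (rule cmp_in[of _ "X \<boxtimes> (Y \<boxtimes> X)"])
    show "assoc C X Y X \<in> Mor C ((X \<boxtimes> Y) \<boxtimes> X) (X \<boxtimes> (Y \<boxtimes> X))"
      using assoc_iso[of X Y X] assms unfolding iso_mor_def inverse_mor_def by blast
    have "runit C X \<in> Mor C (X \<boxtimes> unit C) X"
      using runit_iso[of X] assms unfolding iso_mor_def inverse_mor_def by blast
    then show "runit C X \<cdot> (ident C X \<star> ev) \<in> Mor C (X \<boxtimes> (Y \<boxtimes> X)) X"
      using cmp_in[of "X \<boxtimes> (Y \<boxtimes> X)" "X \<boxtimes> unit C" X] tens_mor_in[of X X "Y \<boxtimes> X" "unit C"]
        obs assms ident_in by blast
  qed (use obs assms in auto)
  ultimately have "lunit C X = 0"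
    using zigzag cmp_zero_right[of "unit C \<boxtimes> X" "(X \<boxtimes> Y) \<boxtimes> X" X] obs assms by simp
  then show False using iso_mor_nonzero[OF lunit_iso[of X]] obs(6) assms(1,3) by auto
qed

end

context fusion_category
begin

text \<open>By semisimplicity, a nonzero morphism out of the simple unit object is the inclusion of a
  summand.\<close>

lemma unit_mor_split:
  assumes "Y \<in> Ob C" "f \<in> Mor C (unit C) Y" "f \<noteq> 0"
  obtains r where "r \<in> Mor C Y (unit C)" "r \<cdot> f = ident C (unit C)"
proof -
  note 1 = unit_Ob
  have "Y \<in> direct_sums C {X. simple_object C X}" using semisimple assms by blast
  then obtain n F where F: "F ` {..<n::nat} \<subseteq> {X. simple_object C X}"
    and ds: "is_direct_sum C {..<n} F Y" unfolding direct_sums_def by blast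
  obtain i p where ip: "\<And>a. a \<in> {..<n} \<Longrightarrow> F a \<in> Ob C"
    "\<And>a. a \<in> {..<n} \<Longrightarrow> i a \<in> Mor C (F a) Y" "\<And>a. a \<in> {..<n} \<Longrightarrow> p a \<in> Mor C Y (F a)"
    "(\<Sum>a\<in>{..<n}. i a \<cdot> p a) = ident C Y"
    by (rule direct_sumE[OF ds]) blast
  obtain a where a: "a \<in> {..<n}" "p a \<cdot> f \<noteq> 0"
    using direct_sum_eq_zeroI[OF assms(1) 1 assms(2) ip] assms(3) by blast
  have pf: "p a \<cdot> f \<in> Mor C (unit C) (F a)" using cmp_in[of _ Y] 1 ip a assms by blast
  have "mono_mor C (unit C) (F a) (p a \<cdot> f)"
    using mono_of_simple_source[OF unit_simple _ pf a(2)] kernel_ex[OF 1 _ pf] ip a by blast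
  moreover have "simple_object C (F a)" using F a by blast
  ultimately have "iso_mor C (unit C) (F a) (p a \<cdot> f)"
    using unit_simple 1 unfolding simple_object_def by blast
  then obtain d where d: "d \<in> Mor C (F a) (unit C)" "d \<cdot> (p a \<cdot> f) = ident C (unit C)"
    unfolding iso_mor_def inverse_mor_def by blast
  show thesis
  proof
    show "d \<cdot> p a \<in> Mor C Y (unit C)"
      using cmp_in[of Y "F a" "unit C" "p a" d] 1 ip a assms(1) d by blast
    show "d \<cdot> p a \<cdot> f = ident C (unit C)"
      using cmp_assoc[of "unit C" Y "F a" "unit C" f "p a" d] 1 ip a assms d by simp
  qed
qed

text \<open>Since \<open>1\<close> is a summand of \<open>Y \<boxtimes> Y*\<close>, the object \<open>X\<close> is a summand of \<open>(X \<boxtimes> Y) \<boxtimes> Y*\<close>.\<close>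

lemma tens_nonzero:
  assumes "X \<in> Ob C" "Y \<in> Ob C" "ident C X \<noteq> 0" "ident C Y \<noteq> 0"
  shows "ident C (X \<boxtimes> Y) \<noteq> 0"
proof
  assume z: "ident C (X \<boxtimes> Y) = 0"
  obtain Y' where "is_dual C Y Y'" using left_dual_ex assms by blast
  then obtain ev coev where Y': "Y' \<in> Ob C" and ev: "ev \<in> Mor C (Y' \<boxtimes> Y) (unit C)"
    and coev: "coev \<in> Mor C (unit C) (Y \<boxtimes> Y')"
    and zz: "runit C Y \<cdot> (ident C Y \<star> ev) \<cdot> assoc C Y Y' Y \<cdot> (coev \<star> ident C Y) = lunit C Y"
    unfolding is_dual_def by blast
  have obs: "X \<boxtimes> Y \<in> Ob C" "(X \<boxtimes> Y) \<boxtimes> Y' \<in> Ob C" "X \<boxtimes> (Y \<boxtimes> Y') \<in> Ob C" "unit C \<in> Ob C"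
    "X \<boxtimes> unit C \<in> Ob C" "Y \<boxtimes> Y' \<in> Ob C"
    using tens_Ob unit_Ob assms Y' by auto
  obtain r where r: "r \<in> Mor C (Y \<boxtimes> Y') (unit C)" "r \<cdot> coev = ident C (unit C)"
    using unit_mor_split[OF _ coev coev_nonzero[OF assms(2) Y' assms(4) ev zz]] obs by blast
  have "ident C ((X \<boxtimes> Y) \<boxtimes> Y') = 0"
    using tens_ident[of "X \<boxtimes> Y" Y'] z tens_zero_left[of "X \<boxtimes> Y" "X \<boxtimes> Y" Y' Y'] obs Y' ident_in
    by simp
  then have "zero_object C ((X \<boxtimes> Y) \<boxtimes> Y')" using zero_object_iff_ident obs by blast
  moreover have "assoc C X Y Y' \<in> Mor C ((X \<boxtimes> Y) \<boxtimes> Y') (X \<boxtimes> (Y \<boxtimes> Y'))"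
    using assoc_iso[of X Y Y'] assms Y' unfolding iso_mor_def inverse_mor_def by blast
  ultimately have "assoc C X Y Y' = 0" using obs(3) unfolding zero_object_def by blast
  then have z3: "ident C (X \<boxtimes> (Y \<boxtimes> Y')) = 0"
    using iso_mor_nonzero[OF assoc_iso[of X Y Y']] obs assms Y' by blast
  then have "zero_object C (X \<boxtimes> (Y \<boxtimes> Y'))" using zero_object_iff_ident obs by blast
  moreover have m: "ident C X \<star> coev \<in> Mor C (X \<boxtimes> unit C) (X \<boxtimes> (Y \<boxtimes> Y'))"
    "ident C X \<star> r \<in> Mor C (X \<boxtimes> (Y \<boxtimes> Y')) (X \<boxtimes> unit C)"
    using tens_mor_in obs assms coev r ident_in by auto
  ultimately have m0: "ident C X \<star> coev = 0"
    using obs unfolding zero_object_def by blast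
  have "ident C (X \<boxtimes> unit C) = (ident C X \<cdot> ident C X) \<star> (r \<cdot> coev)"
    using tens_ident[of X "unit C"] cmp_ident[of X X "ident C X"] ident_in r obs assms by simp
  also have "\<dots> = (ident C X \<star> r) \<cdot> (ident C X \<star> coev)"
    by (rule tens_cmp[of X X X "unit C" "Y \<boxtimes> Y'" "unit C"]) (use obs assms coev r ident_in in auto)
  also have "\<dots> = 0" using m0 cmp_zero_right[OF _ _ _ m(2)] obs by auto
  finally have "zero_object C (X \<boxtimes> unit C)" using zero_object_iff_ident obs by blast
  moreover have "runit C X \<in> Mor C (X \<boxtimes> unit C) X"
    using runit_iso[of X] assms unfolding iso_mor_def inverse_mor_def by blast
  ultimately have "runit C X = 0" using assms(1) unfolding zero_object_def by blast
  then show False using iso_mor_nonzero[OF runit_iso[of X]] obs(5) assms(1,3) by auto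
qed

end

section \<open>Gradings of fusion categories\<close>

text \<open>These are the objects all of whose homogeneous components have degree in \<open>H\<close>, as distinct
  components admit no nonzero morphisms. Phrasing this through morphisms into \<open>X\<close>, rather than
  through decompositions of \<open>X\<close>, makes closure under subobjects and direct sums immediate.\<close>

definition supported_on ::
    "('k::field, 'o, 'm::ab_group_add, 'z) monoidal_cat_scheme \<Rightarrow> 'g monoid \<Rightarrow> ('g \<Rightarrow> 'o set)
       \<Rightarrow> 'g set \<Rightarrow> 'o set" where
  "supported_on C G D H = {X \<in> Ob C. \<forall>g\<in>carrier G - H. \<forall>Z\<in>D g. Mor C Z X = {0}}"

context fusion_category
begin

context
  fixes G :: "'g monoid" and D :: "'g \<Rightarrow> 'o set"
  assumes gr: "grading C G D"
begin

interpretation G: group G using gr unfolding grading_def by simp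

lemma grading_full_abelian: "g \<in> carrier G \<Longrightarrow> full_abelian_subcategory C (D g)"
  and grading_Ob: "Ob C = direct_sums C (\<Union>g\<in>carrier G. D g)"
  and grading_mor: "\<lbrakk>g \<in> carrier G; h \<in> carrier G; g \<noteq> h; X \<in> D g; Y \<in> D h\<rbrakk> \<Longrightarrow> Mor C X Y = {0}"
  and grading_dual: "g \<in> carrier G \<Longrightarrow> {Y. \<exists>X\<in>D g. is_dual C X Y} = D (inv\<^bsub>G\<^esub> g)"
  and tens_component:
    "\<lbrakk>g \<in> carrier G; h \<in> carrier G; X \<in> D g; Y \<in> D h\<rbrakk> \<Longrightarrow> X \<boxtimes> Y \<in> D (g \<otimes>\<^bsub>G\<^esub> h)"
  using gr unfolding grading_def by simp_all

lemma component_Ob: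
  assumes "g \<in> carrier G" "X \<in> D g"
  shows "X \<in> Ob C"
  using grading_full_abelian[OF assms(1), unfolded full_abelian_subcategory_def, THEN conjunct1]
    assms(2) by (rule subsetD)

lemma component_replete:
  assumes "g \<in> carrier G" "X \<in> D g" "isomorphic C X Y"
  shows "Y \<in> D g"
  using grading_full_abelian[OF assms(1), unfolded full_abelian_subcategory_def,
      THEN conjunct2, THEN conjunct1] direct_sums_replete[OF assms(3,2)]
  by (rule subsetD)

lemma mor_components_zero:
  assumes "g \<in> carrier G" "h \<in> carrier G" "X \<in> D g" "Y \<in> D h" "f \<in> Mor C X Y" "f \<noteq> 0"
  shows "g = h"
  using grading_mor[OF assms(1,2) _ assms(3,4)] assms(5,6) by (cases "g = h") simp_all

lemma degree_unique:
  assumes "g \<in> carrier G" "h \<in> carrier G" "X \<in> D g" "Y \<in> D h" "isomorphic C X Y" "ident C X \<noteq> 0"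
  shows "g = h"
proof -
  have "X \<in> D h" using component_replete[OF assms(2,4) isomorphic_sym[OF assms(5)]] .
  then show ?thesis
    using mor_components_zero[OF assms(1,2,3) _ ident_in] component_Ob assms by blast
qed

lemma decomposition:
  assumes "X \<in> Ob C"
  obtains n deg F i p where "\<And>a. a < n \<Longrightarrow> deg a \<in> carrier G" "\<And>a. a < n \<Longrightarrow> F a \<in> D (deg a)"
    "\<And>a. a < n \<Longrightarrow> F a \<in> Ob C"
    "\<And>a. a < n \<Longrightarrow> i a \<in> Mor C (F a) X" "\<And>a. a < n \<Longrightarrow> p a \<in> Mor C X (F a)"
    "(\<Sum>a<n::nat. i a \<cdot> p a) = ident C X"
proof -
  have "X \<in> direct_sums C (\<Union>g\<in>carrier G. D g)" using assms grading_Ob by blast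
  then obtain n F where F: "F ` {..<n::nat} \<subseteq> (\<Union>g\<in>carrier G. D g)"
    and ds: "is_direct_sum C {..<n} F X" unfolding direct_sums_def by blast
  have "\<forall>a\<in>{..<n}. \<exists>g. g \<in> carrier G \<and> F a \<in> D g" using F by blast
  then obtain deg where "\<forall>a\<in>{..<n}. deg a \<in> carrier G \<and> F a \<in> D (deg a)" by metis
  then show thesis by (rule_tac direct_sumE[OF ds], rule_tac that[of n deg F]) auto
qed

lemma simple_homogeneous:
  assumes "simple_object C X"
  obtains g where "g \<in> carrier G" "X \<in> D g"
proof -
  have "X \<in> direct_sums C (\<Union>g\<in>carrier G. D g)"
    using grading_Ob simple_ident_nonzero(1)[OF assms] by blast
  then obtain A where A: "A \<in> (\<Union>g\<in>carrier G. D g)" "isomorphic C A X"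
    by (rule simple_in_direct_sums[OF assms])
  then show thesis using component_replete that by blast
qed

text \<open>The degree of \<open>1\<close> is idempotent because \<open>1 \<boxtimes> 1 \<simeq> 1\<close>.\<close>

lemma unit_component: "unit C \<in> D \<one>\<^bsub>G\<^esub>"
proof -
  obtain g where g: "g \<in> carrier G" "unit C \<in> D g" by (rule simple_homogeneous[OF unit_simple])
  have "ident C (unit C \<boxtimes> unit C) \<noteq> 0"
    using tens_nonzero simple_ident_nonzero[OF unit_simple] by blast
  then have "g \<otimes>\<^bsub>G\<^esub> g = g"
    using degree_unique[OF _ g(1) tens_component[OF g(1,1,2,2)] g(2) isomorphic_unit_tens[OF unit_Ob]]
      g by blast
  then have "g = \<one>\<^bsub>G\<^esub>" using g(1) by (metis G.l_cancel_one)
  then show ?thesis using g by simp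
qed

lemma tens_pow_component:
  assumes "g \<in> carrier G" "X \<in> D g"
  shows "tens_pow C X n \<in> D (g [^]\<^bsub>G\<^esub> n)"
  by (induction n) (use assms unit_component tens_component in auto)

text \<open>A nonzero morphism from \<open>1\<close> to the \<open>n\<close>-th tensor power of \<open>X\<close> forces the degrees \<open>\<one>\<close> and
  \<open>g\<^sup>n\<close> of these objects to agree.\<close>

lemma degree_pow_object_order:
  assumes "g \<in> carrier G" "X \<in> D g"
  shows "g [^]\<^bsub>G\<^esub> object_order C X = \<one>\<^bsub>G\<^esub>"
proof (cases "\<exists>n\<ge>1. multiplicity_of C (unit C) (tens_pow C X n) > 0")
  case True
  then have "multiplicity_of C (unit C) (tens_pow C X (object_order C X)) > 0"
    unfolding object_order_def using LeastI_ex[OF True[simplified]] by simp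
  then have "Mor C (unit C) (tens_pow C X (object_order C X)) \<noteq> {0}"
    by (rule multiplicity_pos_nonzero_mor)
  moreover have "0 \<in> Mor C (unit C) (tens_pow C X (object_order C X))"
    using zero_in_Mor unit_Ob tens_pow_Ob component_Ob assms by blast
  ultimately obtain f where "f \<in> Mor C (unit C) (tens_pow C X (object_order C X))" "f \<noteq> 0" by blast
  then show ?thesis
    using mor_components_zero[OF _ _ unit_component tens_pow_component[OF assms]] assms by fastforce
next
  case False
  then show ?thesis unfolding object_order_def by auto
qed

lemma degree_self_dual:
  assumes "g \<in> carrier G" "X \<in> D g" "self_dual C X" "ident C X \<noteq> 0"
  shows "g \<otimes>\<^bsub>G\<^esub> g = \<one>\<^bsub>G\<^esub>"
proof -
  obtain Y where Y: "is_dual C X Y" "isomorphic C X Y" using assms(3) unfolding self_dual_def by blast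
  have "Y \<in> D (inv\<^bsub>G\<^esub> g)" using grading_dual[OF assms(1)] assms(2) Y by blast
  then have "g = inv\<^bsub>G\<^esub> g" using degree_unique[OF _ _ assms(2) _ Y(2) assms(4)] assms by simp
  then show ?thesis using assms(1) by (metis G.r_inv)
qed

lemma supported_on_mor_zero:
  assumes "X \<in> supported_on C G D H" "g \<in> carrier G" "g \<notin> H" "Z \<in> D g" "t \<in> Mor C Z X"
  shows "t = 0"
  using assms unfolding supported_on_def by blast

lemma supported_onI:
  assumes "X \<in> Ob C"
    and "\<And>g Z t. g \<in> carrier G \<Longrightarrow> g \<notin> H \<Longrightarrow> Z \<in> D g \<Longrightarrow> Z \<in> Ob C \<Longrightarrow> t \<in> Mor C Z X \<Longrightarrow> t = 0"
  shows "X \<in> supported_on C G D H"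
proof -
  have "Mor C Z X = {0}" if "g \<in> carrier G - H" "Z \<in> D g" for g Z
    using assms(2)[of g Z] zero_in_Mor[OF _ assms(1), of Z] component_Ob[of g Z] that by auto
  then show ?thesis unfolding supported_on_def using assms(1) by simp
qed

lemma component_supported_on:
  assumes "g \<in> carrier G" "X \<in> D g" "g \<in> H"
  shows "X \<in> supported_on C G D H"
  unfolding supported_on_def
  using mor_components_zero[OF _ assms(1) _ assms(2)] zero_in_Mor component_Ob assms by blast

text \<open>For tensor products, decompose both factors into homogeneous pieces: a pair of pieces with
  degrees in \<open>H\<close> contributes a piece with degree in \<open>H\<close>, and all other pairs contain a zero piece.\<close>

lemma tens_supported_on:
  assumes "submonoid H G" "X \<in> supported_on C G D H" "Y \<in> supported_on C G D H"
  shows "X \<boxtimes> Y \<in> supported_on C G D H"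
proof -
  have X: "X \<in> Ob C" and Y: "Y \<in> Ob C" using assms unfolding supported_on_def by auto
  obtain n d F i p where 1: "\<And>a. a < n \<Longrightarrow> d a \<in> carrier G" "\<And>a. a < n \<Longrightarrow> F a \<in> D (d a)"
    "\<And>a. a < n \<Longrightarrow> F a \<in> Ob C"
    "\<And>a. a < n \<Longrightarrow> i a \<in> Mor C (F a) X" "\<And>a. a < n \<Longrightarrow> p a \<in> Mor C X (F a)"
    "(\<Sum>a<n::nat. i a \<cdot> p a) = ident C X"
    by (rule decomposition[OF X]) blast
  obtain m e E j q where 2: "\<And>b. b < m \<Longrightarrow> e b \<in> carrier G" "\<And>b. b < m \<Longrightarrow> E b \<in> D (e b)"
    "\<And>b. b < m \<Longrightarrow> E b \<in> Ob C"
    "\<And>b. b < m \<Longrightarrow> j b \<in> Mor C (E b) Y" "\<And>b. b < m \<Longrightarrow> q b \<in> Mor C Y (E b)"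
    "(\<Sum>b<m::nat. j b \<cdot> q b) = ident C Y"
    by (rule decomposition[OF Y]) blast
  let ?I = "{..<n} \<times> {..<m}"
  have i0: "i a = 0" if "a < n" "d a \<notin> H" for a
    using supported_on_mor_zero[OF assms(2) 1(1)[OF that(1)] that(2) 1(2,4)[OF that(1)]] .
  have j0: "j b = 0" if "b < m" "e b \<notin> H" for b
    using supported_on_mor_zero[OF assms(3) 2(1)[OF that(1)] that(2) 2(2,4)[OF that(1)]] .
  have ip: "i a \<cdot> p a \<in> Mor C X X" if "a < n" for a
    using cmp_in[of X "F a" X "p a" "i a"] X 1(3-5)[OF that] by simp
  have jq: "j b \<cdot> q b \<in> Mor C Y Y" if "b < m" for b
    using cmp_in[of Y "E b" Y "q b" "j b"] Y 2(3-5)[OF that] by simp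
  have tens_ijpq: "(i a \<cdot> p a) \<star> (j b \<cdot> q b) = (i a \<star> j b) \<cdot> (p a \<star> q b)" if "a < n" "b < m" for a b
    using tens_cmp[of X "F a" X Y "E b" Y] X Y 1(3-5)[OF that(1)] 2(3-5)[OF that(2)] by simp
  have sum: "(\<Sum>c\<in>?I. (i (fst c) \<star> j (snd c)) \<cdot> (p (fst c) \<star> q (snd c))) = ident C (X \<boxtimes> Y)"
  proof -
    have "ident C (X \<boxtimes> Y) = (\<Sum>a<n. i a \<cdot> p a) \<star> ident C Y"
      using tens_ident[OF X Y] 1(6) by simp
    also have "\<dots> = (\<Sum>a<n. (i a \<cdot> p a) \<star> (\<Sum>b<m. j b \<cdot> q b))"
      unfolding 2(6) by (rule sum_tens[OF X X Y Y]) (use ip Y ident_in in auto)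
    also have "\<dots> = (\<Sum>a<n. \<Sum>b<m. (i a \<cdot> p a) \<star> (j b \<cdot> q b))"
      by (intro sum.cong refl tens_sum[OF X X Y Y]) (use ip jq in auto)
    also have "\<dots> = (\<Sum>a<n. \<Sum>b<m. (i a \<star> j b) \<cdot> (p a \<star> q b))"
      by (intro sum.cong refl) (use tens_ijpq in auto)
    finally show ?thesis by (simp add: sum.cartesian_product case_prod_unfold)
  qed
  show ?thesis
  proof (rule supported_onI)
    show XY: "X \<boxtimes> Y \<in> Ob C" using tens_Ob[OF X Y] .
    fix g Z t
    assume g: "g \<in> carrier G" "g \<notin> H" "Z \<in> D g" and Z: "Z \<in> Ob C"
      and t: "t \<in> Mor C Z (X \<boxtimes> Y)"
    show "t = 0"
    proof (rule direct_sum_eq_zeroI[OF XY Z t _ _ _ sum])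
      fix c assume "c \<in> ?I"
      then obtain a b where ab: "c = (a, b)" "a < n" "b < m" by auto
      note a = 1(1-5)[OF ab(2)] and b = 2(1-5)[OF ab(3)]
      show FE: "F (fst c) \<boxtimes> E (snd c) \<in> Ob C" using ab(1) tens_Ob[OF a(3) b(3)] by simp
      show "i (fst c) \<star> j (snd c) \<in> Mor C (F (fst c) \<boxtimes> E (snd c)) (X \<boxtimes> Y)"
        using ab(1) tens_mor_in[OF a(3) X b(3) Y a(4) b(4)] by simp
      show pq: "p (fst c) \<star> q (snd c) \<in> Mor C (X \<boxtimes> Y) (F (fst c) \<boxtimes> E (snd c))"
        using ab(1) tens_mor_in[OF X a(3) Y b(3) a(5) b(5)] by simp
      show "i (fst c) \<star> j (snd c) = 0 \<or> p (fst c) \<star> q (snd c) \<cdot> t = 0"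
      proof (cases "d a \<in> H \<and> e b \<in> H")
        case True
        then have ne: "g \<noteq> d a \<otimes>\<^bsub>G\<^esub> e b" using g(2) submonoid.m_closed[OF assms(1)] by blast
        have "p a \<star> q b \<cdot> t \<in> Mor C Z (F a \<boxtimes> E b)"
          using cmp_in[OF Z XY FE t pq] ab(1) by simp
        then have "p a \<star> q b \<cdot> t = 0"
          using mor_components_zero[OF g(1) _ g(3) tens_component[OF a(1) b(1) a(2) b(2)]]
            ne a(1) b(1) by blast
        then show ?thesis using ab(1) by simp
      next
        case False
        then have "i a = 0 \<or> j b = 0" using i0[OF ab(2)] j0[OF ab(3)] by blast
        then show ?thesis
          using tens_zero_left[OF a(3) X b(3) Y b(4)] tens_zero_right[OF a(3) X b(3) Y a(4)] ab(1)
          by auto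
      qed
    qed
  qed
qed

lemma fusion_subcategory_supported_on:
  assumes "submonoid H G"
  shows "fusion_subcategory C (supported_on C G D H)"
  unfolding fusion_subcategory_def
proof (intro conjI ballI allI impI)
  let ?E = "supported_on C G D H"
  show sub: "?E \<subseteq> Ob C" unfolding supported_on_def by blast
  show "unit C \<in> ?E"
    using component_supported_on[OF G.one_closed unit_component submonoid.one_closed[OF assms]] .
  show "X \<boxtimes> Y \<in> ?E" if "X \<in> ?E" "Y \<in> ?E" for X Y using tens_supported_on[OF assms that] .
  show "direct_sums C ?E \<subseteq> ?E"
  proof
    fix X assume "X \<in> direct_sums C ?E"
    then obtain n F where F: "F ` {..<n::nat} \<subseteq> ?E" and ds: "is_direct_sum C {..<n} F X"
      unfolding direct_sums_def by blast
    obtain i p where ip: "X \<in> Ob C" "\<And>a. a \<in> {..<n} \<Longrightarrow> F a \<in> Ob C"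
      "\<And>a. a \<in> {..<n} \<Longrightarrow> i a \<in> Mor C (F a) X" "\<And>a. a \<in> {..<n} \<Longrightarrow> p a \<in> Mor C X (F a)"
      "(\<Sum>a\<in>{..<n}. i a \<cdot> p a) = ident C X"
      by (rule direct_sumE[OF ds]) blast
    show "X \<in> ?E"
    proof (rule supported_onI[OF ip(1)])
      fix g Z t
      assume g: "g \<in> carrier G" "g \<notin> H" "Z \<in> D g" and Z: "Z \<in> Ob C" and t: "t \<in> Mor C Z X"
      show "t = 0"
      proof (rule direct_sum_eq_zeroI[OF ip(1) Z t ip(2-5)])
        fix a assume a: "a \<in> {..<n}"
        then have "F a \<in> ?E" using F by blast
        from supported_on_mor_zero[OF this g cmp_in[OF Z ip(1) ip(2)[OF a] t ip(4)[OF a]]]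
        show "i a = 0 \<or> p a \<cdot> t = 0" ..
      qed
    qed
  qed
  show "Y \<in> ?E" if X: "X \<in> ?E" and Y: "Y \<in> Ob C" and f: "mono_mor C Y X f" for X Y f
  proof (rule supported_onI[OF Y])
    have XO: "X \<in> Ob C" using X sub by blast
    have fm: "f \<in> Mor C Y X"
      and cancel: "\<And>T u v. \<lbrakk>T \<in> Ob C; u \<in> Mor C T Y; v \<in> Mor C T Y; f \<cdot> u = f \<cdot> v\<rbrakk> \<Longrightarrow> u = v"
      using f unfolding mono_mor_def by blast+
    fix g Z t
    assume g: "g \<in> carrier G" "g \<notin> H" "Z \<in> D g" and Z: "Z \<in> Ob C" and t: "t \<in> Mor C Z Y"
    have "f \<cdot> t = 0" using supported_on_mor_zero[OF X g cmp_in[OF Z Y XO t fm]] .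
    then show "t = 0"
      using cancel[OF Z t zero_in_Mor[OF Z Y]] cmp_zero_right[OF Z Y XO fm] by simp
  qed
qed

end

text \<open>The objects supported on \<open>H\<close> form a fusion subcategory containing \<open>S\<close>, hence all objects.
  A nonzero object of degree outside \<open>H\<close>, provided by faithfulness, is not supported on \<open>H\<close>, as
  witnessed by its identity.\<close>

lemma degrees_of_generators:
  fixes G :: "'g monoid"
  assumes fg: "faithful_grading C G D" and H: "submonoid H G"
    and gen: "generated_subcategory C S = Ob C" and simp: "\<And>X. X \<in> S \<Longrightarrow> simple_object C X"
    and deg: "\<And>X g. X \<in> S \<Longrightarrow> g \<in> carrier G \<Longrightarrow> X \<in> D g \<Longrightarrow> g \<in> H"
  shows "H = carrier G"
proof
  show "H \<subseteq> carrier G" using submonoid.subset[OF H] .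
  have gr: "grading C G D" using fg unfolding faithful_grading_def by (rule conjunct1)
  have nonzero: "\<exists>X\<in>D g. \<not> zero_object C X" if "g \<in> carrier G" for g
    using fg[unfolded faithful_grading_def, THEN conjunct2] that by (rule bspec)
  have "S \<subseteq> supported_on C G D H"
  proof
    fix X assume X: "X \<in> S"
    obtain g where g: "g \<in> carrier G" "X \<in> D g" using simple_homogeneous[OF gr simp[OF X]] .
    show "X \<in> supported_on C G D H" using component_supported_on[OF gr g deg[OF X g]] .
  qed
  then have all: "Ob C \<subseteq> supported_on C G D H"
    using fusion_subcategory_supported_on[OF gr H] unfolding gen[symmetric] generated_subcategory_def
    by blast
  show "carrier G \<subseteq> H"
  proof (rule subsetI, rule ccontr)
    fix g assume g: "g \<in> carrier G" "g \<notin> H"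
    obtain X where X: "X \<in> D g" "\<not> zero_object C X"
      using nonzero[OF g(1)] by blast
    have XO: "X \<in> Ob C" using component_Ob[OF gr g(1) X(1)] .
    then have "ident C X = 0"
      using supported_on_mor_zero[OF gr _ g X(1) ident_in] all by blast
    then show False using X(2) zero_object_iff_ident[OF XO] by blast
  qed
qed

end

text \<open>The nonzero object \<open>X \<boxtimes> Y \<simeq> Y \<boxtimes> X\<close> has only one degree.\<close>

lemma (in braided_fusion_category) comm_group_of_faithful_grading:
  fixes G :: "'g monoid"
  assumes fg: "faithful_grading C G D"
  shows "comm_group G"
proof -
  have gr: "grading C G D" using fg unfolding faithful_grading_def by (rule conjunct1)
  interpret G: group G using gr unfolding grading_def by simp
  show ?thesis
  proof (rule G.group_comm_groupI)
    fix g h assume g: "g \<in> carrier G" and h: "h \<in> carrier G"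
    have nonzero: "\<forall>g\<in>carrier G. \<exists>X\<in>D g. \<not> zero_object C X"
      using fg unfolding faithful_grading_def by (rule conjunct2)
    obtain X Y where X: "X \<in> D g" "\<not> zero_object C X" and Y: "Y \<in> D h" "\<not> zero_object C Y"
      using bspec[OF nonzero g] bspec[OF nonzero h] by blast
    have obs: "X \<in> Ob C" "Y \<in> Ob C" using component_Ob[OF gr g X(1)] component_Ob[OF gr h Y(1)] .
    then have "ident C (X \<boxtimes> Y) \<noteq> 0"
      using X(2) Y(2) zero_object_iff_ident tens_nonzero[OF obs] by blast
    moreover have "isomorphic C (X \<boxtimes> Y) (Y \<boxtimes> X)"
      unfolding isomorphic_def using braid_iso[OF obs] tens_Ob[OF obs] tens_Ob[OF obs(2,1)] by blast
    ultimately show "g \<otimes>\<^bsub>G\<^esub> h = h \<otimes>\<^bsub>G\<^esub> g"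
      using degree_unique[OF gr _ _ tens_component[OF gr g h X(1) Y(1)]
          tens_component[OF gr h g Y(1) X(1)]]
        g h by simp
  qed
qed

section \<open>Exponents of universal grading groups\<close>

text \<open>Orders of elements divide both the exponent and \<open>N\<close>, so their gcd also annihilates the group
  and minimality applies to it.\<close>

lemma (in group) group_exponent_dvd:
  assumes "\<And>x. x \<in> carrier G \<Longrightarrow> x [^] (N::nat) = \<one>"
  shows "group_exponent G dvd N"
proof (cases "N = 0")
  case False
  let ?P = "\<lambda>n::nat. n \<ge> 1 \<and> (\<forall>x\<in>carrier G. x [^] n = \<one>)"
  have ex: "\<exists>n. ?P n" using assms False by (intro exI[of _ N]) auto
  then have e: "group_exponent G = (LEAST n. ?P n)" unfolding group_exponent_def by auto
  let ?e = "group_exponent G"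
  have "?P ?e" unfolding e using LeastI_ex[OF ex] .
  then have "?P (gcd ?e N)" using assms False by (auto simp: pow_eq_id Suc_le_eq)
  then have "?e \<le> gcd ?e N" unfolding e by (rule Least_le)
  then have "gcd ?e N = ?e" using False
    by (meson dvd_imp_le gcd_dvd1 le_antisym \<open>?P ?e\<close> less_le_trans zero_less_one)
  then show ?thesis by (metis gcd_dvd2)
qed simp

lemma (in comm_group) submonoid_pow_eq_one: "submonoid {x \<in> carrier G. x [^] (n::nat) = \<one>} G"
  by unfold_locales (auto simp: nat_pow_distrib)

theorem proposition4p8:
  fixes C :: "('k::{alg_closed_field, field_char_0}, 'o, 'm::ab_group_add) braided_cat"
    and U :: "'u monoid" and D :: "'u \<Rightarrow> 'o set"
  assumes "braided_fusion_category C"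
    and "universal_grading C U D"
  shows "(\<forall>(n::nat) (X :: nat \<Rightarrow> 'o).
            (\<forall>i\<in>{1..n}. simple_object C (X i)) \<and> generated_subcategory C (X ` {1..n}) = Ob C
              \<longrightarrow> group_exponent U dvd Lcm ((\<lambda>i. object_order C (X i)) ` {1..n}))
       \<and> (\<forall>S :: 'o set.
            (\<forall>X\<in>S. simple_object C X \<and> self_dual C X) \<and> generated_subcategory C S = Ob C
              \<longrightarrow> elementary_abelian_2_group U)"
proof -
  interpret braided_fusion_category C by (rule assms(1))
  have fg: "faithful_grading C U D" using assms(2) unfolding universal_grading_def by (rule conjunct1)
  then have gr: "grading C U D" unfolding faithful_grading_def by (rule conjunct1)
  interpret U: comm_group U by (rule comm_group_of_faithful_grading[OF fg])
  show ?thesis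
  proof (intro conjI allI impI; elim conjE)
    fix n :: nat and X :: "nat \<Rightarrow> 'o"
    assume simp: "\<forall>i\<in>{1..n}. simple_object C (X i)"
      and gen: "generated_subcategory C (X ` {1..n}) = Ob C"
    define N where "N = Lcm ((\<lambda>i. object_order C (X i)) ` {1..n})"
    have "g [^]\<^bsub>U\<^esub> N = \<one>\<^bsub>U\<^esub>" if "g \<in> carrier U" "X i \<in> D g" "i \<in> {1..n}" for g i
    proof -
      have "object_order C (X i) dvd N" unfolding N_def using that by (intro dvd_Lcm) auto
      then show ?thesis
        using degree_pow_object_order[OF gr that(1,2)] U.pow_eq_id[OF that(1)] dvd_trans by blast
    qed
    then have "{g \<in> carrier U. g [^]\<^bsub>U\<^esub> N = \<one>\<^bsub>U\<^esub>} = carrier U"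
      using simp by (intro degrees_of_generators[OF fg U.submonoid_pow_eq_one gen]) auto
    then show "group_exponent U dvd Lcm ((\<lambda>i. object_order C (X i)) ` {1..n})"
      unfolding N_def[symmetric] by (intro U.group_exponent_dvd) blast
  next
    fix S :: "'o set"
    assume S: "\<forall>X\<in>S. simple_object C X \<and> self_dual C X" and gen: "generated_subcategory C S = Ob C"
    have sq: "g [^]\<^bsub>U\<^esub> (2::nat) = g \<otimes>\<^bsub>U\<^esub> g" if "g \<in> carrier U" for g
      using that by (simp add: numeral_2_eq_2)
    have torsion: "{g \<in> carrier U. g [^]\<^bsub>U\<^esub> (2::nat) = \<one>\<^bsub>U\<^esub>} = carrier U"
      using S sq degree_self_dual[OF gr] simple_ident_nonzero
      by (intro degrees_of_generators[OF fg U.submonoid_pow_eq_one gen]) auto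
    have "g \<otimes>\<^bsub>U\<^esub> g = \<one>\<^bsub>U\<^esub>" if g: "g \<in> carrier U" for g
      using subsetD[OF equalityD2[OF torsion] g] sq[OF g] by simp
    then show "elementary_abelian_2_group U"
      unfolding elementary_abelian_2_group_def using U.comm_group_axioms by blast
  qed
qed

end
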